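(* Let $E,A\in\mathbb R^{n\times n}$ and $B\in\mathbb R^{n\times m}$ with $n,m\ge 1$, and consider the descriptor system $E\dot z(t)=Az(t)+Bu(t)$ with real radius of controllability $$R_c=\min_{\Delta_E,\Delta_A\in\mathbb R^{n\times n},\ \Delta_B\in\mathbb R^{n\times m}}\left\{\left\|[\Delta_E\ \ \Delta_A\ \ \Delta_B]\right\|_F \;:\; (E+\Delta_E,\,A+\Delta_A,\,B+\Delta_B)\text{ is uncontrollable}\right\}.$$ Then computing $R_c$ is equivalent to computing the nearest structured low rank approximation of the matrix $\mathcal C(E,A,B)$, that is, $$R_c=\min_{\Delta_E,\Delta_A\in\mathbb R^{n\times n},\ \Delta_B\in\mathbb R^{n\times m}}\left\{\left\|[\Delta_E\ \ \Delta_A\ \ \Delta_B]\right\|_F \;:\; \mathcal C(E+\Delta_E,\,A+\Delta_A,\,B+\Delta_B)\text{ is not of full row rank}\right\}.$$ In fact, if $\mathcal C(\hat E,\hat A,\hat B)$, with $\hat E=E+\Delta E$, $\hat A=A+\Delta A$, $\hat B=B+\Delta B$, is a nearest structured low rank approximation of $\mathcal C(E,A,B)$, then $$R_c=\left\|[\Delta E\ \ \Delta A\ \ \Delta B]\right\|_F.$$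
   Context: A triple $(E,A,B)$ with $E,A\in\mathbb R^{n\times n}$, $B\in\mathbb R^{n\times m}$ (equivalently the descriptor system $E\dot z=Az+Bu$) is C-controllable if and only if (1) $\operatorname{rank}[sE-A\ \ B]=n$ for all finite $s\in\mathbb C$, and (2) $\operatorname{rank}[E\ \ B]=n$. It is called uncontrollable (C-uncontrollable) if it is not C-controllable. $\mathcal C(E,A,B)\in\mathbb R^{n^2\times n(n+m-1)}$ is the block Toeplitz structured matrix $$\mathcal C(E,A,B)=\begin{bmatrix}-A&B& & & & & & \\ E&0&-A&B& & & & \\ & &E&0& & & & \\ & & & &\ddots& & & \\ & & & & &-A&B& \\ & & & & &E&0&B\end{bmatrix}.$$ It has $n$ block rows of height $n$. For each $j=1,\dots,n-1$ there is a block column of width $n+m$ whose block in block row $j$ is $[-A\ \ B]$, whose block in block row $j+1$ is $[E\ \ 0]$, and whose other blocks are zero; there is one final block column of width $m$ whose block in block row $n$ is $B$ and whose other blocks are zero. (For $n=1$, $\mathcal C(E,A,B)=B$.) A nearest structured low rank approximation (SLRA) of $\mathcal C(E,A,B)$ is a matrix of the form $\mathcal C(E+\Delta E,A+\Delta A,B+\Delta B)$ with real $\Delta E,\Delta A,\Delta B$ that is not of full row rank and for which $\|[\Delta E\ \ \Delta A\ \ \Delta B]\|_F$ is minimal among all real perturbations $(\Delta_E,\Delta_A,\Delta_B)$ such that $\mathcal C(E+\Delta_E,A+\Delta_A,B+\Delta_B)$ is not of full row rank. $\|\cdot\|_F$ is the Frobenius norm. *)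

theory Defs
  imports Complex_Main "Jordan_Normal_Form.Matrix" "Jordan_Normal_Form.DL_Rank"
begin

definition append_cols :: "'a::zero mat \<Rightarrow> 'a mat \<Rightarrow> 'a mat" (infixr \<open>@\<^sub>c\<close> 65) where
  "A @\<^sub>c B = four_block_mat A B (0\<^sub>m 0 (dim_col A)) (0\<^sub>m 0 (dim_col B))"

definition full_row_rank :: "'a::field mat \<Rightarrow> bool" where
  "full_row_rank M \<longleftrightarrow> vec_space.rank (dim_row M) M = dim_row M"

definition frobenius_norm :: "real mat \<Rightarrow> real" where
  "frobenius_norm M = sqrt (\<Sum>i<dim_row M. \<Sum>j<dim_col M. (M $$ (i, j))\<^sup>2)"

definition C_controllable :: "real mat \<Rightarrow> real mat \<Rightarrow> real mat \<Rightarrow> bool" where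
  "C_controllable E A B \<longleftrightarrow>
     (\<forall>s::complex. full_row_rank
        ((s \<cdot>\<^sub>m map_mat complex_of_real E - map_mat complex_of_real A)
           @\<^sub>c map_mat complex_of_real B)) \<and>
     full_row_rank (E @\<^sub>c B)"

(* Entry (i, j) lies in block row i div n.  The columns below (n - 1) * (n + m) form the n - 1
   block columns of width n + m; the remaining m columns form the last block column.
   All block indices are zero-based. *)
definition toeplitz_mat :: "real mat \<Rightarrow> real mat \<Rightarrow> real mat \<Rightarrow> real mat" where
  "toeplitz_mat E A B =
     (let n = dim_row E; m = dim_col B in
      mat (n\<^sup>2) (n * (n + m - 1)) (\<lambda>(i, j).
        let p = i div n; r = i mod n; q = j div (n + m); c = j mod (n + m) in
        if j < (n - 1) * (n + m) then
          if p = q then ((- A) @\<^sub>c B) $$ (r, c)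
          else if p = q + 1 then (E @\<^sub>c 0\<^sub>m n m) $$ (r, c)
          else 0
        else
          if p = n - 1 then B $$ (r, j - (n - 1) * (n + m)) else 0))"

definition perturbations :: "real mat \<Rightarrow> real mat \<Rightarrow> real mat \<Rightarrow> (real mat \<times> real mat \<times> real mat) set"
  where
  "perturbations E A B =
     carrier_mat (dim_row E) (dim_col E) \<times> carrier_mat (dim_row A) (dim_col A)
       \<times> carrier_mat (dim_row B) (dim_col B)"

definition uncontrollable_norms :: "real mat \<Rightarrow> real mat \<Rightarrow> real mat \<Rightarrow> real set" where
  "uncontrollable_norms E A B =
     {frobenius_norm (DE @\<^sub>c DA @\<^sub>c DB) | DE DA DB.
        (DE, DA, DB) \<in> perturbations E A B \<and> \<not> C_controllable (E + DE) (A + DA) (B + DB)}"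

definition slra_norms :: "real mat \<Rightarrow> real mat \<Rightarrow> real mat \<Rightarrow> real set" where
  "slra_norms E A B =
     {frobenius_norm (DE @\<^sub>c DA @\<^sub>c DB) | DE DA DB.
        (DE, DA, DB) \<in> perturbations E A B \<and>
        \<not> full_row_rank (toeplitz_mat (E + DE) (A + DA) (B + DB))}"

definition is_minimum :: "real \<Rightarrow> real set \<Rightarrow> bool" where
  "is_minimum r S \<longleftrightarrow> r \<in> S \<and> (\<forall>x\<in>S. r \<le> x)"

(* LEAST on the reals denotes the minimum only if it is attained. *)
definition controllability_radius :: "real mat \<Rightarrow> real mat \<Rightarrow> real mat \<Rightarrow> real" where
  "controllability_radius E A B = (LEAST r. r \<in> uncontrollable_norms E A B)"

(* The approximating matrix is toeplitz_mat (E + DE) (A + DA) (B + DB); for n = 1 it does not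
   determine DE and DA, so the predicate is stated on the perturbation. *)
definition nearest_slra :: 
  "real mat \<Rightarrow> real mat \<Rightarrow> real mat \<Rightarrow> real mat \<Rightarrow> real mat \<Rightarrow> real mat \<Rightarrow> bool" where
  "nearest_slra E A B DE DA DB \<longleftrightarrow>
     (DE, DA, DB) \<in> perturbations E A B \<and>
     \<not> full_row_rank (toeplitz_mat (E + DE) (A + DA) (B + DB)) \<and>
     (\<forall>(FE, FA, FB) \<in> perturbations E A B.
        \<not> full_row_rank (toeplitz_mat (E + FE) (A + FA) (B + FB)) \<longrightarrow>
        frobenius_norm (DE @\<^sub>c DA @\<^sub>c DB) \<le> frobenius_norm (FE @\<^sub>c FA @\<^sub>c FB))"

end

(* A left null vector of the block Toeplitz matrix, cut into n rows x_0, ..., x_{n-1}, is a chain with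
   x_j A = x_{j+1} E and x_j B = 0.  A left null vector z of [sE - A, B] gives the chain s^j z, one of
   [E, B] the chain (0, ..., 0, z).  Conversely, let a nonzero chain be linearly dependent.  If
   x_0 = 0, then the first nonzero x_r satisfies x_r E = 0.  Otherwise take a dependency
   sum_j p_j x_j = 0 whose polynomial p has minimal degree, split p = (t - s) q over the complex
   numbers and put z = sum_j q_j x_j; then z is nonzero and the shifted combination equals s z, so
   z (sE - A) = 0.  An independent chain spans the whole space, so B = 0; then either E is singular
   or the chain can be prolonged by one vector, which makes it dependent.

   So both sets of norms coincide, and the minimum exists because a chain can be normalised to length
   one, which gives a compact set of candidates. *)
theory Submission
  imports Defs "HOL-Analysis.Function_Topology"
    "HOL-Computational_Algebra.Fundamental_Theorem_Algebra"
begin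

section \<open>Full row rank and left null vectors\<close>

text \<open>Transposition turns the criterion for right null vectors into one for left null vectors.
  Vectors are written as functions on indices, so that later sums carry no carrier
  conditions.\<close>

lemma det_eq_0_iff_left_null_vector:
  fixes N :: "'a::field mat"
  assumes N: "N \<in> carrier_mat n n"
  shows "det N = 0 \<longleftrightarrow> (\<exists>v. (\<exists>i<n. v i \<noteq> 0) \<and> (\<forall>c<n. (\<Sum>i<n. v i * N $$ (i, c)) = 0))"
proof -
  have NT: "N\<^sup>T \<in> carrier_mat n n" using N by simp
  have prod: "(N\<^sup>T *\<^sub>v w) $ c = (\<Sum>i<n. w $ i * N $$ (i, c))"
    if "c < n" "w \<in> carrier_vec n" for c w
    using that N by (auto simp: scalar_prod_def lessThan_atLeast0 mult.commute intro!: sum.cong)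
  have "det N = 0 \<longleftrightarrow> (\<exists>w. w \<in> carrier_vec n \<and> w \<noteq> 0\<^sub>v n \<and> N\<^sup>T *\<^sub>v w = 0\<^sub>v n)"
    using det_0_iff_vec_prod_zero_field[OF NT] det_transpose[OF N] by simp
  also have "\<dots> \<longleftrightarrow> (\<exists>v. (\<exists>i<n. v i \<noteq> 0) \<and> (\<forall>c<n. (\<Sum>i<n. v i * N $$ (i, c)) = 0))"
  proof
    assume "\<exists>w. w \<in> carrier_vec n \<and> w \<noteq> 0\<^sub>v n \<and> N\<^sup>T *\<^sub>v w = 0\<^sub>v n"
    then obtain w where w: "w \<in> carrier_vec n" "w \<noteq> 0\<^sub>v n" "N\<^sup>T *\<^sub>v w = 0\<^sub>v n" by blast
    have "\<exists>i<n. w $ i \<noteq> 0" using w(1,2) by (metis carrier_vecD eq_vecI index_zero_vec)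
    moreover have "\<forall>c<n. (\<Sum>i<n. w $ i * N $$ (i, c)) = 0" using prod w by (metis index_zero_vec(1))
    ultimately show "\<exists>v. (\<exists>i<n. v i \<noteq> 0) \<and> (\<forall>c<n. (\<Sum>i<n. v i * N $$ (i, c)) = 0)" by blast
  next
    assume "\<exists>v. (\<exists>i<n. v i \<noteq> 0) \<and> (\<forall>c<n. (\<Sum>i<n. v i * N $$ (i, c)) = 0)"
    then obtain v where v: "\<exists>i<n. v i \<noteq> 0" "\<forall>c<n. (\<Sum>i<n. v i * N $$ (i, c)) = 0" by blast
    have "vec n v \<noteq> 0\<^sub>v n" using v(1) by (metis index_vec index_zero_vec(1))
    moreover have "N\<^sup>T *\<^sub>v vec n v = 0\<^sub>v n"
      using v(2) N by (intro eq_vecI) (auto simp: prod simp del: index_mult_mat_vec)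
    ultimately show "\<exists>w. w \<in> carrier_vec n \<and> w \<noteq> 0\<^sub>v n \<and> N\<^sup>T *\<^sub>v w = 0\<^sub>v n"
      using vec_carrier by blast
  qed
  finally show ?thesis .
qed

text \<open>Fredholm alternative for row vectors. Applied to the chain itself it decides between
  dependence and spanning; applied to \<open>E\<close> it decides between a singular
  \<open>E\<close> and a chain that can be prolonged.\<close>

lemma square_system_alternative:
  fixes M :: "nat \<Rightarrow> nat \<Rightarrow> 'a::field"
  obtains (singular) v where "\<exists>i<n. v i \<noteq> 0" "\<forall>c<n. (\<Sum>i<n. v i * M i c) = 0"
  | (solvable) "\<And>w. \<exists>y. \<forall>c<n. (\<Sum>i<n. y i * M i c) = w c"
proof (cases "det (mat n n (\<lambda>(i, c). M i c)) = 0")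
  case True
  then show ?thesis
    using singular by (subst (asm) det_eq_0_iff_left_null_vector[of _ n]) auto
next
  case False
  define N where "N = mat n n (\<lambda>(i, c). M i c)"
  have N: "N \<in> carrier_mat n n" by (simp add: N_def)
  obtain Y where Y: "Y \<in> carrier_mat n n" "Y * N = 1\<^sub>m n"
    using det_non_zero_imp_unit[OF N False[folded N_def], of undefined]
    by (auto simp: Units_def ring_mat_def)
  have YN: "(\<Sum>i<n. Y $$ (k, i) * M i c) = (if k = c then 1 else 0)" if "k < n" "c < n" for k c
  proof -
    have "(Y * N) $$ (k, c) = (\<Sum>i<n. Y $$ (k, i) * M i c)"
      using that Y(1) by (auto simp: scalar_prod_def lessThan_atLeast0 N_def intro!: sum.cong)
    then show ?thesis using Y that by simp
  qed
  show ?thesis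
  proof (rule solvable)
    fix w
    show "\<exists>y. \<forall>c<n. (\<Sum>i<n. y i * M i c) = w c"
    proof (intro exI allI impI)
      fix c assume c: "c < n"
      \<comment> \<open>The witness left open by the existential is y = w Y with \<open>Y\<close>
        the inverse of \<open>M\<close>: then y M = w (Y M) = w.\<close>
      have "(\<Sum>i<n. (\<Sum>k<n. w k * Y $$ (k, i)) * M i c)
          = (\<Sum>k<n. w k * (\<Sum>i<n. Y $$ (k, i) * M i c))"
        unfolding sum_distrib_right sum_distrib_left
        by (subst sum.swap) (simp add: mult.assoc)
      also have "\<dots> = (\<Sum>k<n. if k = c then w k else 0)"
        using YN c by (intro sum.cong) auto
      also have "\<dots> = w c" using c by simp
      finally show "(\<Sum>i<n. (\<Sum>k<n. w k * Y $$ (k, i)) * M i c) = w c" .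
    qed
  qed
qed

text \<open>The rank is the size of a maximal independent set \<open>U\<close> of columns. If
  \<open>U\<close> has n elements, they form an invertible matrix, which admits no nonzero left null
  vector. If it has fewer, some nonzero vector annihilates \<open>U\<close>, hence its span, hence
  every column.\<close>

lemma full_row_rank_iff:
  fixes M :: "'a::field mat"
  assumes M: "M \<in> carrier_mat n k"
  shows "full_row_rank M \<longleftrightarrow>
    (\<forall>v. (\<forall>c<k. (\<Sum>i<n. v i * M $$ (i, c)) = 0) \<longrightarrow> (\<forall>i<n. v i = 0))"
proof -
  interpret vec_space "TYPE('a)" n .
  let ?S = "set (cols M)"
  have S: "?S \<subseteq> carrier_vec n" using M cols_dim by blast
  have dimM: "dim_row M = n" "dim_col M = k" using M by auto
  have colsM: "?S = col M ` {..<k}" by (auto simp: cols_def dimM)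
  have scol: "v \<bullet> col M c = (\<Sum>i<n. v $ i * M $$ (i, c))" if "c < k" for v c
    using that M by (auto simp: scalar_prod_def lessThan_atLeast0 intro!: sum.cong)
  obtain U where "finite U" and U: "maximal U (\<lambda>T. T \<subseteq> ?S \<and> lin_indpt T)"
    using maximal_exists_superset[of ?S "\<lambda>T. T \<subseteq> ?S \<and> lin_indpt T" "{}"]
    by (auto simp: lin_dep_def)
  have US: "U \<subseteq> ?S" and liU: "lin_indpt U" using U by (auto simp: maximal_def)
  have rk: "rank M = card U" using rank_card_indpt[OF M U] .
  have le: "card U \<le> n" using li_le_dim(2)[OF fin_dim] US S liU dim_is_n by auto
  obtain us where us: "set us = U" "distinct us" using \<open>finite U\<close> finite_distinct_list by blast
  have lus: "length us = card U" using us distinct_card by fastforce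
  have usc: "us ! i \<in> carrier_vec n" if "i < card U" for i
    using that us lus US S nth_mem by fastforce
  have frr: "full_row_rank M \<longleftrightarrow> card U = n" using rk by (simp add: full_row_rank_def dimM)
  show ?thesis
  proof
    assume "full_row_rank M"
    then have cU: "card U = n" using frr by simp
    define N where "N = mat_of_cols n us"
    have N: "N \<in> carrier_mat n n" using cU lus by (auto simp: N_def)
    have colsN: "cols N = us" unfolding N_def using us US S by (intro cols_mat_of_cols) auto
    have "det N \<noteq> 0"
      using lin_indpt_full_rank[OF N] colsN us liU det_rank_iff[OF N] by auto
    then have no: "\<not> (\<exists>v. (\<exists>i<n. v i \<noteq> 0) \<and> (\<forall>c<n. (\<Sum>i<n. v i * N $$ (i, c)) = 0))"
      using det_eq_0_iff_left_null_vector[OF N] by blast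
    show "\<forall>v. (\<forall>c<k. (\<Sum>i<n. v i * M $$ (i, c)) = 0) \<longrightarrow> (\<forall>i<n. v i = 0)"
    proof (intro allI impI)
      fix v i assume v: "\<forall>c<k. (\<Sum>i<n. v i * M $$ (i, c)) = 0" and i: "i < n"
      have "(\<Sum>i<n. v i * N $$ (i, c)) = 0" if c: "c < n" for c
      proof -
        have "us ! c \<in> ?S" using c cU lus us US nth_mem by fastforce
        then obtain d where d: "d < k" "us ! c = col M d" using colsM by auto
        have "N $$ (i, c) = M $$ (i, d)" if "i < n" for i
          using that c cU lus d dimM by (simp add: N_def mat_of_cols_index)
        then show ?thesis using v d by simp
      qed
      then show "v i = 0" using no i by blast
    qed
  next
    assume inj: "\<forall>v. (\<forall>c<k. (\<Sum>i<n. v i * M $$ (i, c)) = 0) \<longrightarrow> (\<forall>i<n. v i = 0)"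
    show "full_row_rank M"
    proof (rule ccontr)
      assume "\<not> full_row_rank M"
      then have lt: "card U < n" using frr le by simp
      \<comment> \<open>The vectors of \<open>U\<close> as rows, padded with zero rows to a square
        matrix. Since \<open>card U < n\<close>, row \<open>card U\<close> is zero, so
        \<open>N\<close> is singular, and a right null vector of \<open>N\<close> annihilates all of
        \<open>U\<close>.\<close>
      define N where "N = mat\<^sub>r n n (\<lambda>i. if i = card U then 0\<^sub>v n
        else if i < card U then us ! i else 0\<^sub>v n)"
      have N: "N \<in> carrier_mat n n" by (simp add: N_def)
      have "det N = 0" unfolding N_def using lt usc by (intro det_row_0) auto
      then obtain v where v: "v \<in> carrier_vec n" "v \<noteq> 0\<^sub>v n" "N *\<^sub>v v = 0\<^sub>v n"
        using det_0_iff_vec_prod_zero_field[OF N] by blast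
      have vU: "v \<bullet> u = 0" if "u \<in> U" for u
      proof -
        have "u \<in> set us" using that us(1) by simp
        then obtain i where "i < length us" "u = us ! i" by (auto simp: in_set_conv_nth)
        then have i: "i < card U" "u = us ! i" using lus by simp_all
        have "(N *\<^sub>v v) $ i = u \<bullet> v" using i lt N usc by (simp add: N_def)
        then show ?thesis
          using v i lt usc comm_scalar_prod[of u n v] by simp
      qed
      have vS: "v \<bullet> u = 0" if u: "u \<in> ?S" for u
      proof -
        have "u \<in> span U"
        proof (cases "u \<in> U")
          case True
          then show ?thesis using US S in_own_span[of U] by auto
        next
          case False
          then have "lin_dep (insert u U)"
            using U u US unfolding maximal_def by (metis insert_subset insertI1 subset_insertI)
          then show ?thesis
            using lin_dep_iff_in_span[of U u] US S u False liU by auto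
        qed
        moreover have "v \<in> orthogonal_complement (span U)"
          using US S vU v(1) by (subst in_orthogonal_complement_span) (auto simp: orthogonal_complement_def)
        ultimately show ?thesis by (auto simp: orthogonal_complement_def)
      qed
      have "\<forall>c<k. (\<Sum>i<n. v $ i * M $$ (i, c)) = 0"
        using vS scol colsM by (metis imageI lessThan_iff)
      then have "\<forall>i<n. v $ i = 0" using inj by blast
      then show False using v by (metis carrier_vecD eq_vecI index_zero_vec)
    qed
  qed
qed

section \<open>Chains and controllability\<close>

text \<open>The length \<open>k\<close> is kept apart from the dimension \<open>n\<close> because a
  chain of length n may have to be prolonged by one vector. Plain functions over an arbitrary field
  serve the real matrix, the complex pencil and the topological argument alike.\<close>

definition null_chain ::
  "nat \<Rightarrow> nat \<Rightarrow> nat \<Rightarrow> (nat \<Rightarrow> nat \<Rightarrow> 'a::field) \<Rightarrow> (nat \<Rightarrow> nat \<Rightarrow> 'a) \<Rightarrow> (nat \<Rightarrow> nat \<Rightarrow> 'a) \<Rightarrow>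
    (nat \<Rightarrow> nat \<Rightarrow> 'a) \<Rightarrow> bool"
  where "null_chain k n m E A B x \<longleftrightarrow>
    (\<forall>j. Suc j < k \<longrightarrow> (\<forall>c<n. (\<Sum>i<n. x j i * A i c) = (\<Sum>i<n. x (Suc j) i * E i c))) \<and>
    (\<forall>j<k. \<forall>c<m. (\<Sum>i<n. x j i * B i c) = 0)"

text \<open>The first alternative of the disjunction is the point at infinity of the pencil.\<close>

definition pencil_null_vector ::
  "nat \<Rightarrow> nat \<Rightarrow> (nat \<Rightarrow> nat \<Rightarrow> 'a::field) \<Rightarrow> (nat \<Rightarrow> nat \<Rightarrow> 'a) \<Rightarrow> (nat \<Rightarrow> nat \<Rightarrow> 'a) \<Rightarrow> (nat \<Rightarrow> 'a) \<Rightarrow> bool"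
  where "pencil_null_vector n m E A B z \<longleftrightarrow>
    (\<exists>i<n. z i \<noteq> 0) \<and> (\<forall>c<m. (\<Sum>i<n. z i * B i c) = 0) \<and>
    ((\<forall>c<n. (\<Sum>i<n. z i * E i c) = 0) \<or>
     (\<exists>s. \<forall>c<n. s * (\<Sum>i<n. z i * E i c) = (\<Sum>i<n. z i * A i c)))"

section \<open>From null chains to null vectors of the pencil\<close>

lemma sum_combination_mult:
  fixes g :: "nat \<Rightarrow> 'a::comm_ring"
  shows "(\<Sum>i<n. (\<Sum>j<k. g j * x j i) * M i) = (\<Sum>j<k. g j * (\<Sum>i<n. x j i * M i))"
  unfolding sum_distrib_left sum_distrib_right by (subst sum.swap) (simp add: mult.assoc)

text \<open>The variable of the polynomial stands for the shift from \<open>x j\<close> to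
  \<open>x (Suc j)\<close>. A dependency of least degree then acts like a minimal polynomial, and
  its root is the eigenvalue of the pencil; the complex field guarantees that root.\<close>

lemma dependent_null_chain_imp_pencil_null_vector:
  fixes E A B x :: "nat \<Rightarrow> nat \<Rightarrow> complex"
  assumes chain: "null_chain k n m E A B x"
    and nonzero: "\<exists>j<k. \<exists>i<n. x j i \<noteq> 0"
    and dep: "\<exists>p. p \<noteq> 0 \<and> degree p < k \<and> (\<forall>i<n. (\<Sum>j<k. coeff p j * x j i) = 0)"
  shows "\<exists>z. pencil_null_vector n m E A B z"
proof (cases "\<forall>i<n. x 0 i = 0")
  case True
  \<comment> \<open>At the first nonzero member the predecessor is zero, so x_r E = x_(r-1) A = 0: a
    null vector at infinity.\<close>
  define r where "r = (LEAST j. \<exists>i<n. x j i \<noteq> 0)"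
  obtain j where j: "j < k" "\<exists>i<n. x j i \<noteq> 0" using nonzero by blast
  have xr: "\<exists>i<n. x r i \<noteq> 0" unfolding r_def using j(2) by (rule LeastI)
  have "r < k" 
    using Least_le[of "\<lambda>j. \<exists>i<n. x j i \<noteq> 0", OF j(2)] j(1) unfolding r_def by linarith
  obtain q where q: "r = Suc q" using True xr by (cases r) auto
  have "\<forall>i<n. x q i = 0" using not_less_Least[of q "\<lambda>j. \<exists>i<n. x j i \<noteq> 0"] q r_def by simp
  then have "\<forall>c<n. (\<Sum>i<n. x r i * E i c) = 0"
    using chain \<open>r < k\<close> q unfolding null_chain_def by fastforce
  moreover have "\<forall>c<m. (\<Sum>i<n. x r i * B i c) = 0"
    using chain \<open>r < k\<close> unfolding null_chain_def by blast
  ultimately show ?thesis using xr unfolding pencil_null_vector_def by blast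
next
  case x0: False
  define P where "P = (\<lambda>p. p \<noteq> 0 \<and> degree p < k \<and> (\<forall>i<n. (\<Sum>j<k. coeff p j * x j i) = 0))"
  obtain p where p: "P p" and min: "\<And>q. P q \<Longrightarrow> degree p \<le> degree q"
    using dep ex_has_least_nat[of P _ degree] unfolding P_def by blast
  \<comment> \<open>A constant dependency would be a nonzero multiple of x_0, which is nonzero in
    this case; hence \<open>p\<close> has a root.\<close>
  have "degree p \<noteq> 0"
  proof
    assume d: "degree p = 0"
    have "(\<Sum>j<k. coeff p j * x j i) = coeff p 0 * x 0 i" if "i < n" for i
    proof -
      have "(\<Sum>j<k. coeff p j * x j i) = (\<Sum>j\<in>{0}. coeff p j * x j i)"
        using p d by (intro sum.mono_neutral_right) (auto simp: P_def coeff_eq_0)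
      then show ?thesis by simp
    qed
    moreover have "coeff p 0 \<noteq> 0" using p d unfolding P_def by (metis leading_coeff_0_iff)
    ultimately show False using p x0 unfolding P_def by auto
  qed
  then obtain s where "poly p s = 0"
    using fundamental_theorem_of_algebra[of p] constant_degree[of p] by auto
  then obtain q where pq: "p = [:- s, 1:] * q" using poly_eq_0_iff_dvd by blast
  have "q \<noteq> 0" using pq p unfolding P_def by auto
  then have degq: "degree p = Suc (degree q)" unfolding pq by (subst degree_mult_eq) auto
  \<comment> \<open>Since \<open>q\<close> has degree below k - 1, its combinations involve only
    indices j with j + 1 < k. Hence the shifted combination \<open>z'\<close> stays inside the
    chain.\<close>
  define k' where "k' = k - 1"
  have k: "k = Suc k'" "degree q < k'" using p degq unfolding P_def k'_def by auto
  have coeffp: "coeff p j = (case j of 0 \<Rightarrow> 0 | Suc l \<Rightarrow> coeff q l) - s * coeff q j" for j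
    using pq by (simp add: coeff_pCons split: nat.split)
  have topq: "coeff q k' = 0" using k(2) by (simp add: coeff_eq_0)
  define z where "z = (\<lambda>i. \<Sum>j<k'. coeff q j * x j i)"
  define z' where "z' = (\<lambda>i. \<Sum>j<k'. coeff q j * x (Suc j) i)"
  \<comment> \<open>Expanding p = (t - s) q coefficientwise turns the dependency into z' - s z =
    0.\<close>
  have zz': "z' i = s * z i" if "i < n" for i
  proof -
    have "0 = (\<Sum>j<k. coeff p j * x j i)" using p that unfolding P_def by simp
    also have "\<dots> = (\<Sum>j<k. (case j of 0 \<Rightarrow> 0 | Suc l \<Rightarrow> coeff q l) * x j i)
        - s * (\<Sum>j<k. coeff q j * x j i)"
      unfolding coeffp by (simp add: algebra_simps sum_subtractf sum_distrib_left)
    also have "(\<Sum>j<k. (case j of 0 \<Rightarrow> 0 | Suc l \<Rightarrow> coeff q l) * x j i) = z' i"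
      unfolding k(1) sum.lessThan_Suc_shift z'_def by simp
    also have "(\<Sum>j<k. coeff q j * x j i) = z i"
      unfolding k(1) z_def using topq by simp
    finally show ?thesis by simp
  qed
  \<comment> \<open>If \<open>z\<close> vanished, \<open>q\<close> would be a dependency of smaller
    degree than \<open>p\<close>.\<close>
  have "\<exists>i<n. z i \<noteq> 0"
  proof (rule ccontr)
    assume "\<not> (\<exists>i<n. z i \<noteq> 0)"
    then have "P q" using \<open>q \<noteq> 0\<close> k topq unfolding P_def z_def by simp
    then show False using min degq by fastforce
  qed
  moreover have "(\<Sum>i<n. z i * B i c) = 0" if "c < m" for c
    unfolding z_def sum_combination_mult using chain that k(1) unfolding null_chain_def by simp
  moreover have "s * (\<Sum>i<n. z i * E i c) = (\<Sum>i<n. z i * A i c)" if c: "c < n" for c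
  proof -
    \<comment> \<open>The computation is s z E = z' E = z A; its last equality is the chain relation
      applied term by term.\<close>
    have "s * (\<Sum>i<n. z i * E i c) = (\<Sum>i<n. z' i * E i c)"
      using zz' by (simp add: sum_distrib_left mult.assoc)
    also have "\<dots> = (\<Sum>j<k'. coeff q j * (\<Sum>i<n. x (Suc j) i * E i c))"
      unfolding z'_def sum_combination_mult ..
    also have "\<dots> = (\<Sum>j<k'. coeff q j * (\<Sum>i<n. x j i * A i c))"
      using chain c k(1) unfolding null_chain_def by (intro sum.cong) auto
    also have "\<dots> = (\<Sum>i<n. z i * A i c)"
      unfolding z_def sum_combination_mult ..
    finally show ?thesis .
  qed
  ultimately show ?thesis unfolding pencil_null_vector_def by blast
qed

text \<open>Turns the coefficients of a linear dependency into the polynomial that the preceding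
  lemma works with.\<close>

lemma poly_with_coeffs:
  fixes g :: "nat \<Rightarrow> 'a::comm_monoid_add"
  assumes "\<exists>j<k. g j \<noteq> 0"
  obtains p where "p \<noteq> 0" "degree p < k" "\<And>j. j < k \<Longrightarrow> coeff p j = g j"
proof
  let ?p = "Abs_poly (\<lambda>j. if j < k then g j else 0)"
  have c: "coeff ?p j = (if j < k then g j else 0)" for j
    by (subst coeff_Abs_poly[of "k"]) auto
  show "?p \<noteq> 0" using assms c by (metis coeff_0)
  have "degree ?p \<le> k - 1" by (rule degree_le) (use c in auto)
  then show "degree ?p < k" using assms by auto
  show "\<And>j. j < k \<Longrightarrow> coeff ?p j = g j" using c by simp
qed

text \<open>A chain as long as the dimension is the row list of a square matrix, so it is either
  dependent or a basis.\<close>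

lemma null_chain_imp_pencil_null_vector:
  fixes E A B x :: "nat \<Rightarrow> nat \<Rightarrow> complex"
  assumes chain: "null_chain n n m E A B x"
    and nonzero: "\<exists>j<n. \<exists>i<n. x j i \<noteq> 0"
  shows "\<exists>z. pencil_null_vector n m E A B z"
proof (cases rule: square_system_alternative[of n x])
  case (singular v)
  then obtain p where "p \<noteq> 0" "degree p < n" "\<And>j. j < n \<Longrightarrow> coeff p j = v j"
    using poly_with_coeffs by blast
  then show ?thesis
    using singular(2)
    by (intro dependent_null_chain_imp_pencil_null_vector[OF chain nonzero]) (auto intro!: exI[of _ p])
next
  case basis: solvable
  \<comment> \<open>Every unit vector is a combination of chain members, and \<open>B\<close>
    annihilates each of them.\<close>
  have B0: "B i c = 0" if "i < n" "c < m" for i c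
  proof -
    obtain y where y: "\<forall>l<n. (\<Sum>j<n. y j * x j l) = (if l = i then 1 else 0)"
      using basis[of "\<lambda>l. if l = i then 1 else 0"] by blast
    have "B i c = (\<Sum>l<n. (if l = i then 1 else 0) * B l c)"
      using that(1) by (simp add: if_distrib[of "\<lambda>a. a * _"] cong: if_cong)
    also have "\<dots> = (\<Sum>l<n. (\<Sum>j<n. y j * x j l) * B l c)" using y by simp
    also have "\<dots> = (\<Sum>j<n. y j * (\<Sum>l<n. x j l * B l c))" by (rule sum_combination_mult)
    also have "\<dots> = 0" using chain that(2) unfolding null_chain_def by simp
    finally show ?thesis .
  qed
  show ?thesis
  proof (cases rule: square_system_alternative[of n E])
    case (singular v)
    then show ?thesis using B0 unfolding pencil_null_vector_def by auto
  next
    case solvable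
    \<comment> \<open>The new member x_n = u must satisfy u E = x_(n-1) A, solvable because
      \<open>E\<close> is invertible; its condition on \<open>B\<close> holds because
      \<open>B\<close> is zero.\<close>
    obtain u where u: "\<forall>c<n. (\<Sum>i<n. u i * E i c) = (\<Sum>i<n. x (n - 1) i * A i c)"
      using solvable[of "\<lambda>c. \<Sum>i<n. x (n - 1) i * A i c"] by blast
    define x' where "x' = x(n := u)"
    have chain': "null_chain (Suc n) n m E A B x'"
      using chain u B0 unfolding null_chain_def x'_def by (auto simp: less_Suc_eq)
    obtain y where y: "\<forall>i<n. (\<Sum>j<n. y j * x j i) = u i" using basis by blast
    \<comment> \<open>The basis expresses u as the sum of the y_j x_j; the coefficient -1 at index n
      moves u to the other side and makes the dependency nontrivial.\<close>
    have "\<exists>j<Suc n. (if j = n then - 1 else y j) \<noteq> 0" by (intro exI[of _ n]) simp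
    then obtain p where p: "p \<noteq> 0" "degree p < Suc n"
      "\<And>j. j < Suc n \<Longrightarrow> coeff p j = (if j = n then - 1 else y j)"
      using poly_with_coeffs[of "Suc n" "\<lambda>j. if j = n then - 1 else y j"] by blast
    have "\<forall>i<n. (\<Sum>j<Suc n. coeff p j * x' j i) = 0"
      using p(3) y by (simp add: x'_def)
    moreover have "\<exists>j<Suc n. \<exists>i<n. x' j i \<noteq> 0"
    proof -
      obtain j i where "j < n" "i < n" "x j i \<noteq> 0" using nonzero by blast
      then show ?thesis
        unfolding x'_def by (intro exI[of _ j] conjI exI[of _ i]) auto
    qed
    ultimately show ?thesis
      using p(1,2) by (intro dependent_null_chain_imp_pencil_null_vector[OF chain']) blast+
  qed
qed

lemma pencil_null_vector_imp_null_chain: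
  assumes n: "n \<ge> 1" and z: "pencil_null_vector n m E A B z"
  shows "\<exists>x. null_chain n n m E A B x \<and> (\<exists>j<n. \<exists>i<n. x j i \<noteq> 0)"
  using z unfolding pencil_null_vector_def
proof (elim conjE disjE exE)
  fix i assume i: "i < n" "z i \<noteq> 0" and B: "\<forall>c<m. (\<Sum>i<n. z i * B i c) = 0"
    and E: "\<forall>c<n. (\<Sum>i<n. z i * E i c) = 0"
  \<comment> \<open>The null vector sits at the last index, where no relation with \<open>A\<close>
    on the left is imposed; the only relation reaching it demands z E = 0.\<close>
  let ?x = "\<lambda>j. if j = n - 1 then z else (\<lambda>_. 0)"
  have "null_chain n n m E A B ?x"
    using B E unfolding null_chain_def by auto
  moreover have "?x (n - 1) i \<noteq> 0" using i by simp
  ultimately show ?thesis using i n by (intro exI[of _ ?x] conjI exI[of _ "n - 1"] exI[of _ i]) auto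
next
  fix i s assume i: "i < n" "z i \<noteq> 0" and B: "\<forall>c<m. (\<Sum>i<n. z i * B i c) = 0"
    and s: "\<forall>c<n. s * (\<Sum>i<n. z i * E i c) = (\<Sum>i<n. z i * A i c)"
  \<comment> \<open>With x_j = s^j z the relation x_j A = x_(j+1) E is s^j times z A = s z E. For s
    = 0 the chain is still nonzero, since x_0 = z.\<close>
  let ?x = "\<lambda>j i. s ^ j * z i"
  have pull: "(\<Sum>i<n. s ^ j * z i * M i) = s ^ j * (\<Sum>i<n. z i * M i)" for j M
    by (simp add: sum_distrib_left mult.assoc)
  have "null_chain n n m E A B ?x"
    using B s unfolding null_chain_def pull by (auto simp: mult.assoc mult.left_commute)
  moreover have "?x 0 i \<noteq> 0" using i by simp
  ultimately show ?thesis using i n by (intro exI[of _ ?x] conjI exI[of _ 0] exI[of _ i]) auto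
qed

section \<open>The block Toeplitz matrix\<close>

lemma append_cols_carrier [simp, intro]:
  "P \<in> carrier_mat n a \<Longrightarrow> Q \<in> carrier_mat n b \<Longrightarrow> P @\<^sub>c Q \<in> carrier_mat n (a + b)"
  by (auto simp: append_cols_def)

lemma index_append_cols:
  assumes "P \<in> carrier_mat n a" "Q \<in> carrier_mat n b" "i < n" "c < a + b"
  shows "(P @\<^sub>c Q) $$ (i, c) = (if c < a then P $$ (i, c) else Q $$ (i, c - a))"
  using assms by (auto simp: append_cols_def)

lemma all_less_add_iff: "(\<forall>c<a + b::nat. R c) \<longleftrightarrow> (\<forall>c<a. R c) \<and> (\<forall>c<b. R (a + c))"
proof (intro iffI allI impI)
  fix c assume R: "(\<forall>c<a. R c) \<and> (\<forall>c<b. R (a + c))" and c: "c < a + b"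
  show "R c"
  proof (cases "c < a")
    case False
    then have "R (a + (c - a))" using R c by (intro conjunct2[OF R, rule_format]) simp
    then show ?thesis using False by simp
  qed (use R in blast)
qed simp

lemma not_full_row_rank_append_cols_iff:
  fixes P Q :: "'a::field mat"
  assumes P: "P \<in> carrier_mat n a" and Q: "Q \<in> carrier_mat n b"
  shows "\<not> full_row_rank (P @\<^sub>c Q) \<longleftrightarrow>
    (\<exists>v. (\<exists>i<n. v i \<noteq> 0) \<and> (\<forall>c<a. (\<Sum>i<n. v i * P $$ (i, c)) = 0) \<and>
      (\<forall>c<b. (\<Sum>i<n. v i * Q $$ (i, c)) = 0))"
  unfolding full_row_rank_iff[OF append_cols_carrier[OF P Q]] all_less_add_iff
  by (auto simp: index_append_cols[OF P Q])

text \<open>Real equations hold separately for the real and the imaginary part, and one of these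
  parts is nonzero.\<close>

lemma real_null_vector_of_complex:
  fixes M :: "nat \<Rightarrow> nat \<Rightarrow> real" and v :: "nat \<Rightarrow> complex"
  assumes nz: "\<exists>i<n. v i \<noteq> 0"
    and null: "\<forall>c\<in>C. (\<Sum>i<n. v i * complex_of_real (M i c)) = 0"
  shows "\<exists>w. (\<exists>i<n. w i \<noteq> 0) \<and> (\<forall>c\<in>C. (\<Sum>i<n. w i * M i c) = 0)"
proof -
  have "(\<Sum>i<n. Re (v i) * M i c) = 0" "(\<Sum>i<n. Im (v i) * M i c) = 0" if "c \<in> C" for c
    using arg_cong[OF bspec[OF null that], of Re] arg_cong[OF bspec[OF null that], of Im] by simp_all
  moreover have "(\<exists>i<n. Re (v i) \<noteq> 0) \<or> (\<exists>i<n. Im (v i) \<noteq> 0)"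
    using nz by (auto simp: complex_eq_iff)
  ultimately show ?thesis by (elim disjE) (intro exI[of _ "\<lambda>i. Re (v i)"] exI[of _ "\<lambda>i. Im (v i)"]; blast)+
qed

text \<open>Complexified entries in function form, the format of chains and pencil null
  vectors.\<close>

definition cmat :: "real mat \<Rightarrow> nat \<Rightarrow> nat \<Rightarrow> complex" where
  "cmat M i c = complex_of_real (M $$ (i, c))"

lemma not_C_controllable_iff:
  assumes E: "E \<in> carrier_mat n n" and A: "A \<in> carrier_mat n n" and B: "B \<in> carrier_mat n m"
  shows "\<not> C_controllable E A B \<longleftrightarrow> (\<exists>z. pencil_null_vector n m (cmat E) (cmat A) (cmat B) z)"
proof -
  let ?c = complex_of_real
  \<comment> \<open>The rank of [E B] is taken over the reals, whereas pencil null vectors are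
    complex: embed in one direction, take a real or imaginary part in the other.\<close>
  have EB: "\<not> full_row_rank (E @\<^sub>c B) \<longleftrightarrow>
    (\<exists>v. (\<exists>i<n. v i \<noteq> 0) \<and> (\<forall>c<n. (\<Sum>i<n. v i * cmat E i c) = 0) \<and>
      (\<forall>c<m. (\<Sum>i<n. v i * cmat B i c) = 0))" (is "?L \<longleftrightarrow> ?R")
  proof
    assume ?L
    then obtain v where v: "\<exists>i<n. v i \<noteq> 0" "\<forall>c<n. (\<Sum>i<n. v i * E $$ (i, c)) = 0"
        "\<forall>c<m. (\<Sum>i<n. v i * B $$ (i, c)) = 0"
      unfolding not_full_row_rank_append_cols_iff[OF E B] by blast
    have "(\<Sum>i<n. ?c (v i) * cmat M i c) = ?c (\<Sum>i<n. v i * M $$ (i, c))" for M c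
      by (simp add: cmat_def)
    then show ?R using v by (intro exI[of _ "\<lambda>i. ?c (v i)"]) (simp del: of_real_sum)
  next
    assume ?R
    then obtain v where v: "\<exists>i<n. v i \<noteq> 0" "\<forall>c<n. (\<Sum>i<n. v i * cmat E i c) = 0"
        "\<forall>c<m. (\<Sum>i<n. v i * cmat B i c) = 0" by blast
    have "(\<Sum>i<n. v i * ?c ((E @\<^sub>c B) $$ (i, c))) = 0" if c: "c < n + m" for c
    proof (cases "c < n")
      case True
      have "(\<Sum>i<n. v i * ?c ((E @\<^sub>c B) $$ (i, c))) = (\<Sum>i<n. v i * cmat E i c)"
        using True c by (intro sum.cong) (auto simp: index_append_cols[OF E B] cmat_def)
      then show ?thesis using v(2) True by simp
    next
      case False
      have "(\<Sum>i<n. v i * ?c ((E @\<^sub>c B) $$ (i, c))) = (\<Sum>i<n. v i * cmat B i (c - n))"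
        using False c by (intro sum.cong) (auto simp: index_append_cols[OF E B] cmat_def)
      then show ?thesis using v(3) False c by simp
    qed
    then have "\<exists>w. (\<exists>i<n. w i \<noteq> 0) \<and> (\<forall>c\<in>{..<n + m}. (\<Sum>i<n. w i * (E @\<^sub>c B) $$ (i, c)) = 0)"
      using v(1) by (intro real_null_vector_of_complex[of n v]) auto
    then show ?L
      unfolding full_row_rank_iff[OF append_cols_carrier[OF E B]] by auto
  qed
  have pencil: "\<not> full_row_rank ((s \<cdot>\<^sub>m map_mat ?c E - map_mat ?c A) @\<^sub>c map_mat ?c B) \<longleftrightarrow>
    (\<exists>v. (\<exists>i<n. v i \<noteq> 0) \<and> (\<forall>c<n. s * (\<Sum>i<n. v i * cmat E i c) = (\<Sum>i<n. v i * cmat A i c)) \<and>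
      (\<forall>c<m. (\<Sum>i<n. v i * cmat B i c) = 0))" for s
  proof -
    have c: "s \<cdot>\<^sub>m map_mat ?c E - map_mat ?c A \<in> carrier_mat n n" "map_mat ?c B \<in> carrier_mat n m"
      using E A B by auto
    have 1: "(\<Sum>i<n. v i * (s \<cdot>\<^sub>m map_mat ?c E - map_mat ?c A) $$ (i, c))
        = s * (\<Sum>i<n. v i * cmat E i c) - (\<Sum>i<n. v i * cmat A i c)" if "c < n" for v c
      using E A that
      by (simp add: cmat_def sum_distrib_left algebra_simps flip: sum_subtractf)
    have 2: "(\<Sum>i<n. v i * map_mat ?c B $$ (i, c)) = (\<Sum>i<n. v i * cmat B i c)" if "c < m" for v c
      using B that by (simp add: cmat_def)
    show ?thesis unfolding not_full_row_rank_append_cols_iff[OF c] using 1 2 by auto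
  qed
  show ?thesis
    unfolding C_controllable_def de_Morgan_conj not_all pencil EB pencil_null_vector_def by blast
qed

section \<open>Column sums of the block Toeplitz matrix and null chains\<close>

lemma toeplitz_mat_carrier:
  assumes "n \<ge> 1" "E \<in> carrier_mat n n" "B \<in> carrier_mat n m"
  shows "toeplitz_mat E A B \<in> carrier_mat (n * n) ((n - 1) * (n + m) + m)"
proof -
  have "n * (n + m - 1) = (n - 1) * (n + m) + m"
    using assms(1) by (cases n) (auto simp: algebra_simps)
  then show ?thesis using assms by (auto simp: toeplitz_mat_def Let_def power2_eq_square)
qed

lemma div_mult_add_less: "i < n \<Longrightarrow> (p * n + i) div n = p" "i < n \<Longrightarrow> (p * n + i) mod n = i" for n :: nat
  by auto

text \<open>Block column q meets only the block rows q and q + 1.\<close>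

lemma sum_if_two_blocks:
  fixes f g :: "nat \<Rightarrow> 'a::comm_monoid_add"
  assumes "Suc q < n"
  shows "(\<Sum>p<n. if p = q then f p else if p = q + 1 then g p else 0) = f q + g (Suc q)"
proof -
  have "(\<Sum>p<n. if p = q then f p else if p = q + 1 then g p else 0)
      = (\<Sum>p<n. (if p = q then f p else 0) + (if p = Suc q then g p else 0))"
    by (intro sum.cong) auto
  then show ?thesis using assms by (simp add: sum.distrib)
qed

text \<open>A left null vector is cut into n pieces of length n. Block column q then reads x_(q+1) E
  - x_q A = 0 and x_q B = 0, and the final block column reads x_(n-1) B = 0.\<close>

lemma not_full_row_rank_toeplitz_mat_iff:
  assumes n: "n \<ge> 1"
    and E: "E \<in> carrier_mat n n" and A: "A \<in> carrier_mat n n" and B: "B \<in> carrier_mat n m"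
  shows "\<not> full_row_rank (toeplitz_mat E A B) \<longleftrightarrow>
    (\<exists>x. null_chain n n m (\<lambda>i c. E $$ (i, c)) (\<lambda>i c. A $$ (i, c)) (\<lambda>i c. B $$ (i, c)) x \<and>
      (\<exists>j<n. \<exists>i<n. x j i \<noteq> 0))"
proof -
  let ?T = "toeplitz_mat E A B" and ?N = "(n - 1) * (n + m)"
  let ?x = "\<lambda>v j i. v (j * n + i) :: real"
  have T: "?T \<in> carrier_mat (n * n) (?N + m)" using toeplitz_mat_carrier n E B by blast
  have less: "p * n + i < n * n" if "p < n" "i < n" for p i
  proof -
    have "p * n + i < Suc p * n" using that by simp
    also have "\<dots> \<le> n * n" using that by (intro mult_right_mono) auto
    finally show ?thesis .
  qed
  \<comment> \<open>The n * n rows are grouped into n block rows of height n.\<close>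
  have split: "(\<Sum>r<n * n. v r * ?T $$ (r, c))
      = (\<Sum>p<n. \<Sum>i<n. ?x v p i * ?T $$ (p * n + i, c))" for v c
  proof -
    have "(\<Sum>r<n * n. v r * ?T $$ (r, c)) = (\<Sum>p<n. \<Sum>r\<in>{p * n..<p * n + n}. v r * ?T $$ (r, c))"
      by (rule sum.nat_group[symmetric])
    also have "\<dots> = (\<Sum>p<n. \<Sum>i<n. ?x v p i * ?T $$ (p * n + i, c))"
    proof (rule sum.cong)
      fix p
      show "(\<Sum>r\<in>{p * n..<p * n + n}. v r * ?T $$ (r, c)) = (\<Sum>i<n. ?x v p i * ?T $$ (p * n + i, c))"
        using sum.shift_bounds_nat_ivl[of "\<lambda>r. v r * ?T $$ (r, c)" 0 "p * n" n]
        by (simp add: lessThan_atLeast0 add.commute)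
    qed simp
    finally show ?thesis .
  qed
  have ent: "?T $$ (p * n + i, j) =
      (if j < ?N then
        if p = j div (n + m) then ((- A) @\<^sub>c B) $$ (i, j mod (n + m))
        else if p = j div (n + m) + 1 then (E @\<^sub>c 0\<^sub>m n m) $$ (i, j mod (n + m)) else 0
      else if p = n - 1 then B $$ (i, j - ?N) else 0)" if "p < n" "i < n" "j < ?N + m" for p i j
  proof -
    have "n * (n + m - 1) = ?N + m" using n by (cases n) (auto simp: algebra_simps)
    then have "?T $$ (r, j) =
      (if j < ?N then
        if r div n = j div (n + m) then ((- A) @\<^sub>c B) $$ (r mod n, j mod (n + m))
        else if r div n = j div (n + m) + 1 then (E @\<^sub>c 0\<^sub>m n m) $$ (r mod n, j mod (n + m)) else 0
      else if r div n = n - 1 then B $$ (r mod n, j - ?N) else 0)" if "r < n * n" for r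
      using that \<open>j < ?N + m\<close> E B by (simp add: toeplitz_mat_def Let_def power2_eq_square)
    from this[OF less[OF that(1,2)]] show ?thesis
      unfolding div_mult_add_less[OF that(2)] .
  qed
  have mA: "- A \<in> carrier_mat n n" using A by simp
  have Z: "0\<^sub>m n m \<in> carrier_mat n m" by simp
  have col: "(\<Sum>r<n * n. v r * ?T $$ (r, q * (n + m) + c)) =
      (if c < n then (\<Sum>i<n. ?x v (Suc q) i * E $$ (i, c)) - (\<Sum>i<n. ?x v q i * A $$ (i, c))
       else (\<Sum>i<n. ?x v q i * B $$ (i, c - n)))" if q: "Suc q < n" and c: "c < n + m" for v q c
  proof -
    have "q * (n + m) + c < Suc q * (n + m)" using c by simp
    also have "\<dots> \<le> ?N" using q by (intro mult_right_mono) auto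
    finally have lt: "q * (n + m) + c < ?N" .
    have dm: "(q * (n + m) + c) div (n + m) = q" "(q * (n + m) + c) mod (n + m) = c"
      using c div_mult_add_less by blast+
    have "(\<Sum>r<n * n. v r * ?T $$ (r, q * (n + m) + c)) =
      (\<Sum>p<n. if p = q then \<Sum>i<n. ?x v p i * ((- A) @\<^sub>c B) $$ (i, c)
        else if p = q + 1 then \<Sum>i<n. ?x v p i * (E @\<^sub>c 0\<^sub>m n m) $$ (i, c) else 0)"
      unfolding split using lt dm by (intro sum.cong refl) (auto simp: ent)
    also have "\<dots> = (\<Sum>i<n. ?x v q i * ((- A) @\<^sub>c B) $$ (i, c))
        + (\<Sum>i<n. ?x v (Suc q) i * (E @\<^sub>c 0\<^sub>m n m) $$ (i, c))"
      by (rule sum_if_two_blocks[OF q])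
    also have "\<dots> = (if c < n then (\<Sum>i<n. ?x v (Suc q) i * E $$ (i, c)) - (\<Sum>i<n. ?x v q i * A $$ (i, c))
       else (\<Sum>i<n. ?x v q i * B $$ (i, c - n)))"
      using c A by (auto simp: index_append_cols[OF mA B] index_append_cols[OF E Z] sum_negf)
    finally show ?thesis .
  qed
  have last: "(\<Sum>r<n * n. v r * ?T $$ (r, ?N + c)) = (\<Sum>i<n. ?x v (n - 1) i * B $$ (i, c))"
    if c: "c < m" for v c
  proof -
    have "(\<Sum>r<n * n. v r * ?T $$ (r, ?N + c)) =
      (\<Sum>p<n. if p = n - 1 then \<Sum>i<n. ?x v p i * B $$ (i, c) else 0)"
      unfolding split using c by (intro sum.cong refl) (auto simp: ent)
    then show ?thesis using n by simp
  qed
  have null: "(\<forall>c<?N + m. (\<Sum>r<n * n. v r * ?T $$ (r, c)) = 0) \<longleftrightarrow>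
      null_chain n n m (\<lambda>i c. E $$ (i, c)) (\<lambda>i c. A $$ (i, c)) (\<lambda>i c. B $$ (i, c)) (?x v)" for v
  proof
    assume L: "\<forall>c<?N + m. (\<Sum>r<n * n. v r * ?T $$ (r, c)) = 0"
    have inner: "(\<Sum>r<n * n. v r * ?T $$ (r, q * (n + m) + c)) = 0"
      if "Suc q < n" "c < n + m" for q c
    proof -
      have "q * (n + m) + c < Suc q * (n + m)" using that by simp
      also have "\<dots> \<le> ?N" using that by (intro mult_right_mono) auto
      finally show ?thesis using L by simp
    qed
    show "null_chain n n m (\<lambda>i c. E $$ (i, c)) (\<lambda>i c. A $$ (i, c)) (\<lambda>i c. B $$ (i, c)) (?x v)"
      unfolding null_chain_def
    proof (intro conjI allI impI)
      fix q c assume "Suc q < n" "c < n"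
      then show "(\<Sum>i<n. ?x v q i * A $$ (i, c)) = (\<Sum>i<n. ?x v (Suc q) i * E $$ (i, c))"
        using inner[of q c] col[of q c v] by simp
    next
      fix q c assume q: "q < n" and c: "c < m"
      show "(\<Sum>i<n. ?x v q i * B $$ (i, c)) = 0"
      \<comment> \<open>The condition x_q B = 0 comes from the right part of block column q, except
        for q = n - 1, where the narrow final block column supplies it.\<close>
      proof (cases "Suc q < n")
        case True
        then show ?thesis using inner[of q "n + c"] col[of q "n + c" v] c by simp
      next
        case False
        then have "q = n - 1" using q by simp
        then show ?thesis using last[OF c, of v] L[rule_format, of "?N + c"] c by simp
      qed
    qed
  next
    assume R: "null_chain n n m (\<lambda>i c. E $$ (i, c)) (\<lambda>i c. A $$ (i, c)) (\<lambda>i c. B $$ (i, c)) (?x v)"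
    show "\<forall>c<?N + m. (\<Sum>r<n * n. v r * ?T $$ (r, c)) = 0"
      unfolding all_less_add_iff
    proof (intro conjI allI impI)
      fix c assume "c < m"
      then show "(\<Sum>r<n * n. v r * ?T $$ (r, ?N + c)) = 0"
        using last[of c v] R n unfolding null_chain_def by simp
    next
      fix j assume j: "j < ?N"
      define q c where "q = j div (n + m)" and "c = j mod (n + m)"
      have jqc: "j = q * (n + m) + c" unfolding q_def c_def by (rule div_mult_mod_eq[symmetric])
      have "c < n + m" using n unfolding c_def by simp
      moreover have "Suc q < n" 
        using less_mult_imp_div_less[OF j] unfolding q_def by linarith
      ultimately show "(\<Sum>r<n * n. v r * ?T $$ (r, j)) = 0"
        unfolding jqc using col[of q c v] R unfolding null_chain_def by auto
    qed
  qed
  have ex: "(\<exists>r<n * n. v r \<noteq> 0) \<longleftrightarrow> (\<exists>j<n. \<exists>i<n. ?x v j i \<noteq> 0)" for v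
  proof
    assume "\<exists>r<n * n. v r \<noteq> 0"
    then obtain r where r: "r < n * n" "v r \<noteq> 0" by blast
    have "r div n < n" "r mod n < n" using r n by (auto simp: less_mult_imp_div_less)
    then show "\<exists>j<n. \<exists>i<n. ?x v j i \<noteq> 0" using r by (metis div_mult_mod_eq)
  qed (use less in blast)
  show ?thesis
  proof
    assume "\<not> full_row_rank ?T"
    then show "\<exists>x. null_chain n n m (\<lambda>i c. E $$ (i, c)) (\<lambda>i c. A $$ (i, c)) (\<lambda>i c. B $$ (i, c)) x \<and>
      (\<exists>j<n. \<exists>i<n. x j i \<noteq> 0)"
      unfolding full_row_rank_iff[OF T] null using ex by blast
  next
    assume "\<exists>x. null_chain n n m (\<lambda>i c. E $$ (i, c)) (\<lambda>i c. A $$ (i, c)) (\<lambda>i c. B $$ (i, c)) x \<and>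
      (\<exists>j<n. \<exists>i<n. x j i \<noteq> 0)"
    then obtain x where x: "null_chain n n m (\<lambda>i c. E $$ (i, c)) (\<lambda>i c. A $$ (i, c)) (\<lambda>i c. B $$ (i, c)) x"
      "\<exists>j<n. \<exists>i<n. x j i \<noteq> 0" by blast
    \<comment> \<open>The chain is glued back into one long vector. Cutting it again recovers
      \<open>x j i\<close> only for i < n, so the chain conditions are transferred through their
      sums.\<close>
    define v where "v r = x (r div n) (r mod n)" for r
    have xv: "?x v j i = x j i" if "i < n" for j i
      using that by (simp add: v_def)
    have sums: "(\<Sum>i<n. ?x v j i * M i) = (\<Sum>i<n. x j i * M i)" for j M
      by (intro sum.cong refl) (simp add: xv)
    have "null_chain n n m (\<lambda>i c. E $$ (i, c)) (\<lambda>i c. A $$ (i, c)) (\<lambda>i c. B $$ (i, c)) (?x v)"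
      using x(1) unfolding null_chain_def sums .
    moreover have "\<exists>j<n. \<exists>i<n. ?x v j i \<noteq> 0" using x(2) xv by metis
    ultimately show "\<not> full_row_rank ?T"
      unfolding full_row_rank_iff[OF T] null using ex by blast
  qed
qed

text \<open>The eigenvalue s may be non-real although the Toeplitz matrix is real. The chain
  conditions have real coefficients, so the real and imaginary parts of a complex chain are chains;
  conversely, a real chain is a complex one.\<close>

lemma not_C_controllable_iff_toeplitz_mat:
  assumes n: "n \<ge> 1"
    and E: "E \<in> carrier_mat n n" and A: "A \<in> carrier_mat n n" and B: "B \<in> carrier_mat n m"
  shows "\<not> C_controllable E A B \<longleftrightarrow> \<not> full_row_rank (toeplitz_mat E A B)"
proof
  assume "\<not> C_controllable E A B"
  then obtain x where x: "null_chain n n m (cmat E) (cmat A) (cmat B) x" "\<exists>j<n. \<exists>i<n. x j i \<noteq> 0"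
    using not_C_controllable_iff[OF E A B] pencil_null_vector_imp_null_chain[OF n] by blast
  have Re: "(\<Sum>i<n. Re (x j i) * M $$ (i, c)) = Re (\<Sum>i<n. x j i * cmat M i c)"
    and Im: "(\<Sum>i<n. Im (x j i) * M $$ (i, c)) = Im (\<Sum>i<n. x j i * cmat M i c)" for j M c
    by (simp_all add: cmat_def)
  have "null_chain n n m (\<lambda>i c. E $$ (i, c)) (\<lambda>i c. A $$ (i, c)) (\<lambda>i c. B $$ (i, c)) (\<lambda>j i. Re (x j i))"
    "null_chain n n m (\<lambda>i c. E $$ (i, c)) (\<lambda>i c. A $$ (i, c)) (\<lambda>i c. B $$ (i, c)) (\<lambda>j i. Im (x j i))"
    using x(1) unfolding null_chain_def Re Im by simp_all
  moreover have "(\<exists>j<n. \<exists>i<n. Re (x j i) \<noteq> 0) \<or> (\<exists>j<n. \<exists>i<n. Im (x j i) \<noteq> 0)"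
    using x(2) by (auto simp: complex_eq_iff)
  ultimately show "\<not> full_row_rank (toeplitz_mat E A B)"
    unfolding not_full_row_rank_toeplitz_mat_iff[OF assms] by blast
next
  assume "\<not> full_row_rank (toeplitz_mat E A B)"
  then obtain x where
    x: "null_chain n n m (\<lambda>i c. E $$ (i, c)) (\<lambda>i c. A $$ (i, c)) (\<lambda>i c. B $$ (i, c)) x"
      "\<exists>j<n. \<exists>i<n. x j i \<noteq> 0"
    unfolding not_full_row_rank_toeplitz_mat_iff[OF assms] by blast
  have of_real: "(\<Sum>i<n. complex_of_real (x j i) * cmat M i c)
      = complex_of_real (\<Sum>i<n. x j i * M $$ (i, c))" for j M c
    by (simp add: cmat_def)
  have "null_chain n n m (cmat E) (cmat A) (cmat B) (\<lambda>j i. complex_of_real (x j i))"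
    using x(1) unfolding null_chain_def of_real by simp
  then show "\<not> C_controllable E A B"
    using null_chain_imp_pencil_null_vector[of n m] x(2) not_C_controllable_iff[OF E A B] by force
qed

section \<open>Existence of a nearest approximation\<close>

text \<open>The squared Frobenius norm of the joined perturbation, as a continuous function of its
  entries.\<close>

definition block_sum_squares ::
  "nat \<Rightarrow> nat \<Rightarrow> (nat \<Rightarrow> nat \<Rightarrow> real) \<times> (nat \<Rightarrow> nat \<Rightarrow> real) \<times> (nat \<Rightarrow> nat \<Rightarrow> real) \<Rightarrow> real"
  where "block_sum_squares n m = (\<lambda>(f, g, h).
    (\<Sum>i<n. \<Sum>j<n. (f i j)\<^sup>2) + ((\<Sum>i<n. \<Sum>j<n. (g i j)\<^sup>2) + (\<Sum>i<n. \<Sum>j<m. (h i j)\<^sup>2)))"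

lemma frobenius_norm_power2:
  "(frobenius_norm P)\<^sup>2 = (\<Sum>i<dim_row P. \<Sum>j<dim_col P. (P $$ (i, j))\<^sup>2)"
  unfolding frobenius_norm_def by (intro real_sqrt_pow2 sum_nonneg) auto

lemma frobenius_norm_append_cols:
  assumes P: "P \<in> carrier_mat n a" and Q: "Q \<in> carrier_mat n b"
  shows "(frobenius_norm (P @\<^sub>c Q))\<^sup>2 = (frobenius_norm P)\<^sup>2 + (frobenius_norm Q)\<^sup>2"
proof -
  have PQ: "P @\<^sub>c Q \<in> carrier_mat n (a + b)" using P Q by simp
  have "(\<Sum>j<a + b. ((P @\<^sub>c Q) $$ (i, j))\<^sup>2)
      = (\<Sum>j<a. (P $$ (i, j))\<^sup>2) + (\<Sum>j<b. (Q $$ (i, j))\<^sup>2)" if i: "i < n" for i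
  proof -
    have "(\<Sum>j<a + b. ((P @\<^sub>c Q) $$ (i, j))\<^sup>2)
      = (\<Sum>j<a. ((P @\<^sub>c Q) $$ (i, j))\<^sup>2) + (\<Sum>j<b. ((P @\<^sub>c Q) $$ (i, a + j))\<^sup>2)"
      by (induction b) (simp_all add: add.assoc)
    then show ?thesis using i by (simp add: index_append_cols[OF P Q])
  qed
  then show ?thesis
    using carrier_matD[OF PQ] carrier_matD[OF P] carrier_matD[OF Q]
    by (simp add: frobenius_norm_power2 sum.distrib)
qed

lemma frobenius_norm_blocks:
  assumes "P \<in> carrier_mat n n" "Q \<in> carrier_mat n n" "R \<in> carrier_mat n m"
  shows "frobenius_norm (P @\<^sub>c Q @\<^sub>c R)
    = sqrt (block_sum_squares n m (\<lambda>i j. P $$ (i, j), \<lambda>i j. Q $$ (i, j), \<lambda>i j. R $$ (i, j)))"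
proof -
  have "(frobenius_norm (P @\<^sub>c Q @\<^sub>c R))\<^sup>2
    = block_sum_squares n m (\<lambda>i j. P $$ (i, j), \<lambda>i j. Q $$ (i, j), \<lambda>i j. R $$ (i, j))"
    using assms
    by (simp add: frobenius_norm_append_cols[of _ n n _ "n + m"] frobenius_norm_append_cols[of _ n n _ m])
      (simp add: frobenius_norm_power2 block_sum_squares_def)
  moreover have "frobenius_norm (P @\<^sub>c Q @\<^sub>c R) \<ge> 0"
    unfolding frobenius_norm_def by (intro real_sqrt_ge_zero sum_nonneg) auto
  ultimately show ?thesis by (metis real_sqrt_unique)
qed

text \<open>The perturbation is one argument, so that pairs of a perturbation and a chain form a
  topological product space.\<close>

definition chain_perturbation ::
  "nat \<Rightarrow> nat \<Rightarrow> (nat \<Rightarrow> nat \<Rightarrow> real) \<Rightarrow> (nat \<Rightarrow> nat \<Rightarrow> real) \<Rightarrow> (nat \<Rightarrow> nat \<Rightarrow> real) \<Rightarrow>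
    (nat \<Rightarrow> nat \<Rightarrow> real) \<times> (nat \<Rightarrow> nat \<Rightarrow> real) \<times> (nat \<Rightarrow> nat \<Rightarrow> real) \<Rightarrow> (nat \<Rightarrow> nat \<Rightarrow> real) \<Rightarrow> bool"
  where "chain_perturbation n m E A B = (\<lambda>(f, g, h) x.
    null_chain n n m (\<lambda>i c. E i c + f i c) (\<lambda>i c. A i c + g i c) (\<lambda>i c. B i c + h i c) x)"

section \<open>Compactness and closedness of the set of candidates\<close>

lemma compact_box: "compact {f :: nat \<Rightarrow> nat \<Rightarrow> real. \<forall>i j. f i j \<in> {- r..r}}"
proof -
  \<comment> \<open>Tychonoff's theorem for one index; applying it twice covers doubly indexed
    families.\<close>
  have compact_Pi: "compact {f :: nat \<Rightarrow> 'a. \<forall>i. f i \<in> S}" if "compact S"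
    for S :: "'a::topological_space set"
  proof -
    have "compactin (product_topology (\<lambda>_. euclidean) UNIV) (PiE UNIV (\<lambda>_ :: nat. S))"
      using that by (simp add: compactin_PiE)
    moreover have "PiE UNIV (\<lambda>_ :: nat. S) = {f. \<forall>i. f i \<in> S}" by (auto simp: PiE_def)
    ultimately show ?thesis by (simp add: euclidean_product_topology)
  qed
  show ?thesis using compact_Pi[OF compact_Pi[OF compact_Icc[of "- r" r]]] by simp
qed

lemma continuous_on_entry [continuous_intros]:
  fixes F :: "'a::topological_space \<Rightarrow> 'b \<Rightarrow> 'c \<Rightarrow> real"
  assumes "continuous_on S F"
  shows "continuous_on S (\<lambda>p. F p i j)"
  using continuous_on_product_then_coordinatewise[OF continuous_on_product_then_coordinatewise[OF assms]] .

text \<open>The relations are polynomial equations in finitely many entries of the perturbation and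
  the chain, hence closed jointly in both.\<close>

lemma closed_chain_perturbation:
  "closed {p. chain_perturbation n m E A B (fst p) (snd p)}"
  unfolding chain_perturbation_def null_chain_def case_prod_beta
  by (intro closed_Collect_conj closed_Collect_all closed_Collect_imp closed_Collect_eq
      open_Collect_const continuous_intros)

text \<open>Being nonzero is not a closed condition; having length one is, and it keeps limits of
  chains away from zero.\<close>

lemma closed_unit_blocks:
  "closed {p :: ('a::topological_space \<times> (nat \<Rightarrow> nat \<Rightarrow> real)). (\<Sum>j<n. \<Sum>i<n. (snd p j i)\<^sup>2) = 1}"
  by (intro closed_Collect_eq continuous_intros)

lemma abs_entry_le_sqrt_sum_squares:
  fixes f :: "nat \<Rightarrow> nat \<Rightarrow> real"
  assumes "(\<Sum>i<a. \<Sum>j<b. (f i j)\<^sup>2) \<le> r" "i < a" "j < b"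
  shows "\<bar>f i j\<bar> \<le> sqrt r"
proof -
  have "(f i j)\<^sup>2 \<le> (\<Sum>j<b. (f i j)\<^sup>2)"
    using assms(3) by (intro member_le_sum) auto
  also have "\<dots> \<le> (\<Sum>i<a. \<Sum>j<b. (f i j)\<^sup>2)"
    using assms(2) by (intro member_le_sum[where f = "\<lambda>i. \<Sum>j<b. (f i j)\<^sup>2"]) (auto intro: sum_nonneg)
  finally show ?thesis using assms(1) by (intro real_le_rsqrt) simp
qed

lemma null_chain_scale:
  assumes "null_chain k n m E A B x"
  shows "null_chain k n m E A B (\<lambda>j i. a * x j i)"
  using assms unfolding null_chain_def by (simp add: mult.assoc flip: sum_distrib_left)

text \<open>Normalising the chain and truncating the perturbation outside the relevant index range turns
  the minimisation into one over a compact subset of a product of function spaces.\<close>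

lemma nearest_chain_perturbation_exists:
  fixes E A B :: "nat \<Rightarrow> nat \<Rightarrow> real"
  assumes n: "n \<ge> 1"
  obtains p x where "chain_perturbation n m E A B p x" "\<exists>j<n. \<exists>i<n. x j i \<noteq> 0"
    "\<And>q y. chain_perturbation n m E A B q y \<Longrightarrow> \<exists>j<n. \<exists>i<n. y j i \<noteq> 0 \<Longrightarrow>
      block_sum_squares n m p \<le> block_sum_squares n m q"
proof -
  \<comment> \<open>This perturbation cancels all three matrices, so every vector family is a chain
    for it. Its norm \<open>r\<close> bounds the search.\<close>
  define p0 :: "(nat \<Rightarrow> nat \<Rightarrow> real) \<times> (nat \<Rightarrow> nat \<Rightarrow> real) \<times> (nat \<Rightarrow> nat \<Rightarrow> real)"
    where "p0 = (\<lambda>i c. - E i c, \<lambda>i c. - A i c, \<lambda>i c. - B i c)"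
  define r where "r = sqrt (block_sum_squares n m p0)"
  define Box :: "real \<Rightarrow> (nat \<Rightarrow> nat \<Rightarrow> real) set" where "Box s = {f. \<forall>i j. f i j \<in> {- s..s}}" for s
  define K where "K = ((Box r \<times> Box r \<times> Box r) \<times> Box 1) \<inter>
    {p. chain_perturbation n m E A B (fst p) (snd p)} \<inter> {p. (\<Sum>j<n. \<Sum>i<n. (snd p j i)\<^sup>2) = 1}"
  have "compact (Box s)" for s unfolding Box_def by (rule compact_box)
  then have K: "compact K"
    unfolding K_def
    by (intro compact_Int_closed compact_Times closed_chain_perturbation closed_unit_blocks) auto
  \<comment> \<open>The box constrains all indices, while norm and chain conditions see only those
    in range; zeroing the remaining entries brings a candidate into the box without changing
    either.\<close>
  define cut :: "nat \<Rightarrow> nat \<Rightarrow> (nat \<Rightarrow> nat \<Rightarrow> real) \<Rightarrow> nat \<Rightarrow> nat \<Rightarrow> real"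
    where "cut a b f i j = (if i < a \<and> j < b then f i j else 0)" for a b f i j
  have cut_Box: "cut a b f \<in> Box s" if "(\<Sum>i<a. \<Sum>j<b. (f i j)\<^sup>2) \<le> s\<^sup>2" "s \<ge> 0" for a b f s
    using abs_entry_le_sqrt_sum_squares[OF that(1)] that(2) unfolding Box_def cut_def
    by (auto simp: abs_le_iff minus_le_iff)
  have into_K: "\<exists>p x. (p, x) \<in> K \<and> block_sum_squares n m p = block_sum_squares n m q"
    if q: "chain_perturbation n m E A B q y" and y: "\<exists>j<n. \<exists>i<n. y j i \<noteq> 0"
      and le: "block_sum_squares n m q \<le> r\<^sup>2" for q y
  proof -
    obtain f g h where fgh: "q = (f, g, h)" by (cases q) auto
    define p where "p = (cut n n f, cut n n g, cut n m h)"
    define N where "N = (\<Sum>j<n. \<Sum>i<n. (y j i)\<^sup>2)"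
    have "N > 0"
    proof -
      obtain j i where ji: "j < n" "i < n" "y j i \<noteq> 0" using y by blast
      \<comment> \<open>If N were 0, the entry bound with radius 0 would force the nonzero entry of
        \<open>y\<close> to vanish.\<close>
      have "N \<noteq> 0"
        using abs_entry_le_sqrt_sum_squares[of y n n 0 j i] ji unfolding N_def by auto
      moreover have "N \<ge> 0" unfolding N_def by (intro sum_nonneg) auto
      ultimately show ?thesis by simp
    qed
    define x where "x = cut n n (\<lambda>j i. inverse (sqrt N) * y j i)"
    have unit: "(\<Sum>j<n. \<Sum>i<n. (x j i)\<^sup>2) = 1"
    proof -
      have "(\<Sum>j<n. \<Sum>i<n. (x j i)\<^sup>2) = (inverse (sqrt N))\<^sup>2 * N"
        unfolding N_def sum_distrib_left x_def cut_def by (simp add: power_mult_distrib)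
      then show ?thesis using \<open>N > 0\<close> by (simp add: power_inverse)
    qed
    have "chain_perturbation n m E A B p x"
    proof -
      have "null_chain n n m (\<lambda>i c. E i c + f i c) (\<lambda>i c. A i c + g i c) (\<lambda>i c. B i c + h i c)
          (\<lambda>j i. inverse (sqrt N) * y j i)"
        using q by (intro null_chain_scale) (simp add: chain_perturbation_def fgh)
      then show ?thesis
        unfolding chain_perturbation_def p_def x_def null_chain_def cut_def by simp
    qed
    moreover have "p \<in> Box r \<times> Box r \<times> Box r"
    proof -
      have "r \<ge> 0" unfolding r_def block_sum_squares_def by (auto intro!: sum_nonneg add_nonneg_nonneg split: prod.split)
      moreover have "(\<Sum>i<n. \<Sum>j<n. (f i j)\<^sup>2) \<ge> 0" "(\<Sum>i<n. \<Sum>j<n. (g i j)\<^sup>2) \<ge> 0"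
        "(\<Sum>i<n. \<Sum>j<m. (h i j)\<^sup>2) \<ge> 0" by (intro sum_nonneg; simp)+
      ultimately show ?thesis
        using le unfolding p_def fgh block_sum_squares_def by (auto intro!: cut_Box)
    qed
    moreover have "x \<in> Box 1"
      unfolding x_def using unit[unfolded x_def cut_def] by (intro cut_Box) (simp_all add: cut_def)
    ultimately have "(p, x) \<in> K" using unit unfolding K_def by simp
    moreover have "block_sum_squares n m p = block_sum_squares n m q"
      unfolding p_def fgh block_sum_squares_def cut_def by simp
    ultimately show ?thesis by blast
  qed
  have r2: "block_sum_squares n m p0 = r\<^sup>2"
    unfolding r_def p0_def block_sum_squares_def
    by (simp add: real_sqrt_pow2 sum_nonneg add_nonneg_nonneg)
  \<comment> \<open>Any nonzero family would do here; the constant one shows that \<open>K\<close>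
    is nonempty and has a member of squared norm r^2.\<close>
  have "chain_perturbation n m E A B p0 (\<lambda>_ _. 1)"
    unfolding chain_perturbation_def p0_def null_chain_def by simp
  then obtain p1 x1 where p1: "(p1, x1) \<in> K" "block_sum_squares n m p1 = r\<^sup>2"
    using into_K[of p0 "\<lambda>_ _. 1"] r2 n by force
  have "continuous_on K (\<lambda>p. block_sum_squares n m (fst p))"
    unfolding block_sum_squares_def case_prod_beta by (intro continuous_intros)
  then obtain px where px: "px \<in> K"
    "\<And>q. q \<in> K \<Longrightarrow> block_sum_squares n m (fst px) \<le> block_sum_squares n m (fst q)"
    using continuous_attains_inf[OF K] p1(1) by blast
  show thesis
  proof
    show "chain_perturbation n m E A B (fst px) (snd px)" using px(1) unfolding K_def by blast
    show "\<exists>j<n. \<exists>i<n. snd px j i \<noteq> 0"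
    proof (rule ccontr)
      assume "\<not> (\<exists>j<n. \<exists>i<n. snd px j i \<noteq> 0)"
      then have "(\<Sum>j<n. \<Sum>i<n. (snd px j i)\<^sup>2) = 0" by simp
      then show False using px(1) unfolding K_def by simp
    qed
    fix q y assume "chain_perturbation n m E A B q y" "\<exists>j<n. \<exists>i<n. y j i \<noteq> 0"
    \<comment> \<open>A competitor of squared norm at most r^2 has a counterpart in \<open>K\<close>
      of equal norm; any other is beaten by \<open>p1\<close>, which lies in
      \<open>K\<close>.\<close>
    then have "\<exists>p x. (p, x) \<in> K \<and> block_sum_squares n m p = block_sum_squares n m q"
      if "block_sum_squares n m q \<le> r\<^sup>2" using into_K that by blast
    then show "block_sum_squares n m (fst px) \<le> block_sum_squares n m q"
      using px(2) px(2)[OF p1(1)] p1(2) by (cases "block_sum_squares n m q \<le> r\<^sup>2") force+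
  qed
qed

text \<open>Carries the minimiser over entry functions back to matrices: only entries in range enter
  the chain conditions and the norm.\<close>

lemma nearest_slra_exists:
  assumes n: "n \<ge> 1"
    and E: "E \<in> carrier_mat n n" and A: "A \<in> carrier_mat n n" and B: "B \<in> carrier_mat n m"
  shows "\<exists>DE DA DB. nearest_slra E A B DE DA DB"
proof -
  let ?e = "\<lambda>M i c. (M $$ (i, c) :: real)"
  have iff: "\<not> full_row_rank (toeplitz_mat (E + DE) (A + DA) (B + DB)) \<longleftrightarrow>
      (\<exists>x. chain_perturbation n m (?e E) (?e A) (?e B) (?e DE, ?e DA, ?e DB) x \<and>
        (\<exists>j<n. \<exists>i<n. x j i \<noteq> 0))"
    if "DE \<in> carrier_mat n n" "DA \<in> carrier_mat n n" "DB \<in> carrier_mat n m" for DE DA DB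
  proof -
    have "null_chain n n m (?e (E + DE)) (?e (A + DA)) (?e (B + DB)) x \<longleftrightarrow>
        chain_perturbation n m (?e E) (?e A) (?e B) (?e DE, ?e DA, ?e DB) x" for x
      using that E A B unfolding null_chain_def chain_perturbation_def by simp
    then show ?thesis using not_full_row_rank_toeplitz_mat_iff[OF n, of "E + DE" "A + DA" "B + DB" m] that
      by simp
  qed
  obtain p x where px: "chain_perturbation n m (?e E) (?e A) (?e B) p x" "\<exists>j<n. \<exists>i<n. x j i \<noteq> 0"
    and min: "\<And>q y. chain_perturbation n m (?e E) (?e A) (?e B) q y \<Longrightarrow> \<exists>j<n. \<exists>i<n. y j i \<noteq> 0 \<Longrightarrow>
      block_sum_squares n m p \<le> block_sum_squares n m q"
    using nearest_chain_perturbation_exists[OF n, of m "?e E" "?e A" "?e B"] by blast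
  obtain f g h where fgh: "p = (f, g, h)" by (cases p) auto
  define DE DA DB where "DE = mat n n (\<lambda>(i, c). f i c)" and "DA = mat n n (\<lambda>(i, c). g i c)"
    and "DB = mat n m (\<lambda>(i, c). h i c)"
  have D: "DE \<in> carrier_mat n n" "DA \<in> carrier_mat n n" "DB \<in> carrier_mat n m"
    by (simp_all add: DE_def DA_def DB_def)
  have "chain_perturbation n m (?e E) (?e A) (?e B) (?e DE, ?e DA, ?e DB) x"
    using px(1) unfolding fgh chain_perturbation_def null_chain_def
    by (simp add: DE_def DA_def DB_def)
  then have bad: "\<not> full_row_rank (toeplitz_mat (E + DE) (A + DA) (B + DB))"
    unfolding iff[OF D] using px(2) by blast
  have "block_sum_squares n m (?e DE, ?e DA, ?e DB) = block_sum_squares n m p"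
    by (simp add: fgh block_sum_squares_def DE_def DA_def DB_def)
  then have "frobenius_norm (DE @\<^sub>c DA @\<^sub>c DB) \<le> frobenius_norm (FE @\<^sub>c FA @\<^sub>c FB)"
    if "FE \<in> carrier_mat n n" "FA \<in> carrier_mat n n" "FB \<in> carrier_mat n m"
      "\<not> full_row_rank (toeplitz_mat (E + FE) (A + FA) (B + FB))" for FE FA FB
    using min iff[OF that(1-3)] that(4)
    unfolding frobenius_norm_blocks[OF D] frobenius_norm_blocks[OF that(1-3)]
    by (metis real_sqrt_le_iff)
  then have "nearest_slra E A B DE DA DB"
    using D bad E A B unfolding nearest_slra_def perturbations_def by auto
  then show ?thesis by blast
qed

section \<open>The radius as the common minimum of both sets of norms\<close>

theorem mainTheorem2:
  fixes n m :: nat and E A B :: "real mat"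
  assumes "n \<ge> 1" and "m \<ge> 1"
    and "E \<in> carrier_mat n n" and "A \<in> carrier_mat n n" and "B \<in> carrier_mat n m"
  shows "is_minimum (controllability_radius E A B) (uncontrollable_norms E A B) \<and>
         is_minimum (controllability_radius E A B) (slra_norms E A B) \<and>
         (\<forall>DE DA DB. nearest_slra E A B DE DA DB \<longrightarrow>
            controllability_radius E A B = frobenius_norm (DE @\<^sub>c DA @\<^sub>c DB))"
proof -
  have "\<not> C_controllable (E + DE) (A + DA) (B + DB) \<longleftrightarrow>
      \<not> full_row_rank (toeplitz_mat (E + DE) (A + DA) (B + DB))"
    if "(DE, DA, DB) \<in> perturbations E A B" for DE DA DB
    using that assms
    by (intro not_C_controllable_iff_toeplitz_mat[of n _ _ _ m]) (auto simp: perturbations_def)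
  then have norms: "uncontrollable_norms E A B = slra_norms E A B"
    unfolding uncontrollable_norms_def slra_norms_def by blast
  have nearest: "is_minimum (frobenius_norm (DE @\<^sub>c DA @\<^sub>c DB)) (slra_norms E A B)"
    if "nearest_slra E A B DE DA DB" for DE DA DB
    using that unfolding nearest_slra_def is_minimum_def slra_norms_def by blast
  \<comment> \<open>\<open>LEAST\<close> is determined only once a minimum is known to be attained;
    the existence of a nearest approximation supplies it.\<close>
  have radius: "controllability_radius E A B = r" if "is_minimum r (slra_norms E A B)" for r
    using that unfolding controllability_radius_def norms is_minimum_def
    by (intro Least_equality) auto
  obtain DE DA DB where "nearest_slra E A B DE DA DB"
    using nearest_slra_exists[of n E A B m] assms by blast
  then show ?thesis using nearest radius norms by metis
qed

end
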